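(* Let $1\leq k\leq n$ and let $G$ be a graph on $n$ vertices with exactly $k$ connected components. Then $$F(G)\leq (k-1)+\sum_{i=1}^{n-k+1}\binom{n-k+1}{i}h_i,$$ with equality if and only if $G$ is isomorphic to $(k-1)K_1\cup K_{n-k+1}$.
   Context: All graphs are finite, simple and undirected. A connected subgraph of a graph $G=(V,E)$ is a graph $(V',E')$ with $\emptyset\neq V'\subseteq V$, $E'\subseteq E$, every edge of $E'$ having both endpoints in $V'$, and $(V',E')$ connected; distinct pairs $(V',E')$ are counted separately. The core index $F(G)$ is the number of connected subgraphs of $G$ (for a disconnected graph it is the sum of the core indices of its components). $h_i$ denotes the number of connected labeled graphs on $i$ labeled vertices. $K_m$ is the complete graph on $m$ vertices, $G_1\cup G_2$ is the disjoint union, and $mG$ is the disjoint union of $m$ copies of $G$. *)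

theory Defs
  imports Complex_Main
begin

type_synonym 'a ugraph = "'a set \<times> 'a set set"

abbreviation verts :: "'a ugraph \<Rightarrow> 'a set" where "verts \<equiv> fst"
abbreviation edges :: "'a ugraph \<Rightarrow> 'a set set" where "edges \<equiv> snd"

definition simple_graph :: "'a ugraph \<Rightarrow> bool" where
  "simple_graph G \<longleftrightarrow> finite (verts G) \<and> (\<forall>e\<in>edges G. e \<subseteq> verts G \<and> card e = 2)"

definition adj :: "'a ugraph \<Rightarrow> ('a \<times> 'a) set" where
  "adj G = {(u, v). {u, v} \<in> edges G}"

text \<open>Reachability by a walk; the empty walk exists only at vertices of \<open>G\<close>.\<close>

definition reach :: "'a ugraph \<Rightarrow> ('a \<times> 'a) set" where
  "reach G = {(u, v). u \<in> verts G \<and> v \<in> verts G \<and> (u, v) \<in> (adj G)\<^sup>*}"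

definition connected_graph :: "'a ugraph \<Rightarrow> bool" where
  "connected_graph G \<longleftrightarrow>
     verts G \<noteq> {} \<and> (\<forall>u\<in>verts G. \<forall>v\<in>verts G. (u, v) \<in> reach G)"

definition induced_subgraph :: "'a ugraph \<Rightarrow> 'a set \<Rightarrow> 'a ugraph" where
  "induced_subgraph G C = (C, {e \<in> edges G. e \<subseteq> C})"

definition components :: "'a ugraph \<Rightarrow> 'a ugraph set" where
  "components G = induced_subgraph G ` (verts G // reach G)"

definition subgraph :: "'a ugraph \<Rightarrow> 'a ugraph \<Rightarrow> bool" where
  "subgraph H G \<longleftrightarrow>
     verts H \<subseteq> verts G \<and> edges H \<subseteq> edges G \<and> (\<forall>e\<in>edges H. e \<subseteq> verts H)"

definition connected_subgraphs :: "'a ugraph \<Rightarrow> 'a ugraph set" where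
  "connected_subgraphs G = {H. subgraph H G \<and> connected_graph H}"

text \<open>Used for disconnected graphs as well; \<open>core_index_eq_sum_components\<close> below shows that
  the result is then the sum of the core indices of the components.\<close>

definition core_index :: "'a ugraph \<Rightarrow> nat" where
  "core_index G = card (connected_subgraphs G)"

definition num_connected_labeled :: "nat \<Rightarrow> nat" where
  "num_connected_labeled i =
     card {H :: nat ugraph. verts H = {1..i} \<and> simple_graph H \<and> connected_graph H}"

definition complete_graph :: "nat \<Rightarrow> nat ugraph" where
  "complete_graph m = ({..<m}, {e. e \<subseteq> {..<m} \<and> card e = 2})"

definition disjoint_union :: "'a ugraph \<Rightarrow> 'b ugraph \<Rightarrow> ('a + 'b) ugraph" where
  "disjoint_union G H =
     (Inl ` verts G \<union> Inr ` verts H, (\<lambda>e. Inl ` e) ` edges G \<union> (\<lambda>e. Inr ` e) ` edges H)"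

definition copies :: "nat \<Rightarrow> 'a ugraph \<Rightarrow> (nat \<times> 'a) ugraph" where
  "copies m G = ({..<m} \<times> verts G, {Pair i ` e | i e. i < m \<and> e \<in> edges G})"

definition graph_iso :: "'a ugraph \<Rightarrow> 'b ugraph \<Rightarrow> bool" where
  "graph_iso G H \<longleftrightarrow>
     (\<exists>f. bij_betw f (verts G) (verts H) \<and>
       (\<forall>u\<in>verts G. \<forall>v\<in>verts G. {u, v} \<in> edges G \<longleftrightarrow> {f u, f v} \<in> edges H))"

lemma equiv_reach: "equiv (verts G) (reach G)"
proof (rule equivI)
  have "sym (adj G)"
    by (auto simp: sym_def adj_def insert_commute)
  then have "sym ((adj G)\<^sup>*)"
    by (rule sym_rtrancl)
  then show "sym (reach G)"
    by (auto simp: sym_def reach_def)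
  show "trans (reach G)"
    by (auto simp: trans_def reach_def)
qed (auto simp: reach_def refl_on_def)

lemma reach_mono:
  assumes "subgraph H G" "(u, v) \<in> reach H"
  shows "(u, v) \<in> reach G"
proof -
  have "adj H \<subseteq> adj G"
    using assms(1) by (auto simp: subgraph_def adj_def)
  then show ?thesis
    using assms rtrancl_mono[of "adj H" "adj G"] by (auto simp: reach_def subgraph_def)
qed

lemma connected_subgraphs_eq_Union_components:
  "connected_subgraphs G = (\<Union>C\<in>components G. connected_subgraphs C)"
proof (intro equalityI subsetI)
  fix H assume H: "H \<in> connected_subgraphs G"
  then obtain u where u: "u \<in> verts H"
    by (auto simp: connected_subgraphs_def connected_graph_def)
  let ?C = "reach G `` {u}"
  have uG: "u \<in> verts G"
    using H u by (auto simp: connected_subgraphs_def subgraph_def)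
  have sub: "verts H \<subseteq> ?C"
    using H u reach_mono[of H G u] by (auto simp: connected_subgraphs_def connected_graph_def)
  have "subgraph H (induced_subgraph G ?C)"
    using H sub by (fastforce simp: connected_subgraphs_def subgraph_def induced_subgraph_def)
  then have "H \<in> connected_subgraphs (induced_subgraph G ?C)"
    using H by (auto simp: connected_subgraphs_def)
  moreover have "induced_subgraph G ?C \<in> components G"
    using uG by (auto simp: components_def quotient_def)
  ultimately show "H \<in> (\<Union>C\<in>components G. connected_subgraphs C)"
    by blast
next
  fix H assume "H \<in> (\<Union>C\<in>components G. connected_subgraphs C)"
  then obtain C where C: "C \<in> verts G // reach G"
    and H: "H \<in> connected_subgraphs (induced_subgraph G C)"
    by (auto simp: components_def)
  have "C \<subseteq> verts G"
    using C by (auto simp: quotient_def reach_def)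
  then show "H \<in> connected_subgraphs G"
    using H by (fastforce simp: connected_subgraphs_def subgraph_def induced_subgraph_def)
qed

lemma core_index_eq_sum_components:
  assumes "simple_graph G"
  shows "core_index G = (\<Sum>C\<in>components G. core_index C)"
proof -
  have fin: "finite (verts G)" and "edges G \<subseteq> Pow (verts G)"
    using assms by (auto simp: simple_graph_def)
  then have "finite (edges G)"
    by (meson finite_Pow_iff finite_subset)
  moreover have "connected_subgraphs G \<subseteq> Pow (verts G) \<times> Pow (edges G)"
    by (force simp: connected_subgraphs_def subgraph_def)
  ultimately have finG: "finite (connected_subgraphs G)"
    using fin by (meson finite_Pow_iff finite_SigmaI finite_subset)
  have "reach G \<subseteq> verts G \<times> verts G"
    by (auto simp: reach_def)
  then have "finite (components G)"
    using fin by (simp add: components_def finite_quotient)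
  moreover have "\<forall>C\<in>components G. finite (connected_subgraphs C)"
    using finG connected_subgraphs_eq_Union_components[of G] by (metis UN_upper finite_subset)
  moreover have "connected_subgraphs C \<inter> connected_subgraphs D = {}"
    if CD: "C \<in> components G" "D \<in> components G" "C \<noteq> D" for C D
  proof -
    obtain X Y where "X \<in> verts G // reach G" "Y \<in> verts G // reach G"
      and XY: "C = induced_subgraph G X" "D = induced_subgraph G Y"
      using CD by (auto simp: components_def)
    then have "X \<inter> Y = {}"
      using quotient_disj[OF equiv_reach] CD(3) by blast
    then have "verts C \<inter> verts D = {}"
      using XY by (simp add: induced_subgraph_def)
    then show ?thesis
      by (auto simp: connected_subgraphs_def subgraph_def connected_graph_def)
  qed
  ultimately show ?thesis
    unfolding core_index_def connected_subgraphs_eq_Union_components[of G]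
    by (intro card_UN_disjoint) auto
qed

end

theory Submission
  imports Defs
begin

text \<open>Write \<open>N m\<close> for the core index of a complete graph on \<open>m\<close> vertices. Two complete graphs sharing
  a single vertex sit inside the complete graph on the union of their vertex sets, and their only
  common connected subgraph is the shared vertex. Hence \<open>g a = N (a + 1) - 1\<close> is superadditive,
  strictly so at positive arguments, because an edge joining the two parts is a further connected
  subgraph. A component with \<open>c\<close> vertices has core index at most \<open>g (c - 1) + 1\<close>, with equality only
  if it is complete, and the numbers \<open>c - 1\<close> add up to \<open>n - k\<close>; so the core index of the whole graph
  is at most \<open>k + g (n - k)\<close>, and equality forces all components to be complete and all but one of
  them to be single vertices.\<close>

text \<open>Unlike \<open>complete_graph\<close>, this lives on any vertex set of any type, so a
  component can be compared with the complete graph on its own vertices.\<close>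

definition complete_on :: "'a set \<Rightarrow> 'a ugraph" where
  "complete_on S = (S, {e. e \<subseteq> S \<and> card e = 2})"

definition connected_graphs_on :: "'a set \<Rightarrow> 'a ugraph set" where
  "connected_graphs_on T = {H. verts H = T \<and> simple_graph H \<and> connected_graph H}"

text \<open>The sum from the bound, as a function of the order alone;
  \<open>core_index_complete_on\<close> identifies it as the core index of a complete graph.\<close>

definition complete_core_index :: "nat \<Rightarrow> nat" where
  "complete_core_index m = (\<Sum>i = 1..m. (m choose i) * num_connected_labeled i)"

definition map_graph :: "('a \<Rightarrow> 'b) \<Rightarrow> 'a ugraph \<Rightarrow> 'b ugraph" where
  "map_graph f H = (f ` verts H, (`) f ` edges H)"

section \<open>Counting connected subgraphs of complete graphs\<close>

lemma connected_graph_map_graph: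
  assumes "connected_graph H"
  shows "connected_graph (map_graph f H)"
proof -
  have "(f u, f v) \<in> (adj (map_graph f H))\<^sup>*" if "(u, v) \<in> (adj H)\<^sup>*" for u v
    using that
  proof (induction rule: rtrancl_induct)
    case (step y z)
    then have "(f y, f z) \<in> adj (map_graph f H)"
      using image_eqI[of "{f y, f z}" "(`) f" "{y, z}" "edges H"]
      by (simp add: adj_def map_graph_def)
    with step.IH show ?case by simp
  qed simp
  then show ?thesis
    using assms by (auto simp: connected_graph_def reach_def map_graph_def)
qed

lemma simple_graph_map_graph:
  assumes "simple_graph H" "inj_on f (verts H)"
  shows "simple_graph (map_graph f H)"
proof -
  have "card (f ` e) = 2" if "e \<in> edges H" for e
    using that assms card_image[of f e] inj_on_subset[of f "verts H" e]
    by (auto simp: simple_graph_def)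
  then show ?thesis
    using assms(1) by (auto simp: simple_graph_def map_graph_def)
qed

lemma finite_connected_graphs_on:
  assumes "finite T"
  shows "finite (connected_graphs_on T)"
proof (rule finite_subset)
  show "connected_graphs_on T \<subseteq> {T} \<times> Pow (Pow T)"
    by (auto simp: connected_graphs_on_def simple_graph_def)
  show "finite ({T} \<times> Pow (Pow T))"
    using assms by simp
qed

text \<open>Relabelling vertices along \<open>f\<close> is injective on graphs because taking images
  is injective on subsets of \<open>T\<close>. The inverse bijection supplies the opposite
  inequality.\<close>

lemma card_connected_graphs_on_le:
  fixes f :: "'a \<Rightarrow> 'b"
  assumes "finite T" "bij_betw f T T'"
  shows "card (connected_graphs_on T) \<le> card (connected_graphs_on T')"
proof (rule card_inj_on_le)
  have inj: "inj_on f T" and im: "f ` T = T'"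
    using assms(2) by (auto simp: bij_betw_def)
  show "inj_on (map_graph f) (connected_graphs_on T)"
  proof (rule inj_onI)
    fix H H' assume H: "H \<in> connected_graphs_on T" and H': "H' \<in> connected_graphs_on T"
      and eq: "map_graph f H = map_graph f H'"
    have "(`) f ` edges H = (`) f ` edges H'"
      using eq by (simp add: map_graph_def)
    moreover have "inj_on ((`) f) (Pow T)"
      using inj by (rule inj_on_image_Pow)
    moreover have "edges H \<subseteq> Pow T" "edges H' \<subseteq> Pow T"
      using H H' by (auto simp: connected_graphs_on_def simple_graph_def)
    ultimately have "edges H = edges H'"
      by (meson inj_on_image_eq_iff)
    then show "H = H'"
      using H H' by (simp add: connected_graphs_on_def prod_eq_iff)
  qed
  show "map_graph f ` connected_graphs_on T \<subseteq> connected_graphs_on T'"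
    using inj im connected_graph_map_graph simple_graph_map_graph
    by (fastforce simp: connected_graphs_on_def map_graph_def)
  show "finite (connected_graphs_on T')"
    using assms(1) im by (auto intro: finite_connected_graphs_on)
qed

lemma card_connected_graphs_on:
  assumes "finite T"
  shows "card (connected_graphs_on T) = num_connected_labeled (card T)"
proof -
  obtain f where f: "bij_betw f T {1..card T}"
    using finite_same_card_bij[OF assms, of "{1..card T}"] by auto
  have "card (connected_graphs_on T) = card (connected_graphs_on {1..card T})"
    using card_connected_graphs_on_le[OF assms f]
      card_connected_graphs_on_le[OF _ bij_betw_inv_into[OF f]] by simp
  then show ?thesis
    by (simp add: num_connected_labeled_def connected_graphs_on_def)
qed

lemma finite_connected_subgraphs:
  assumes "simple_graph G"
  shows "finite (connected_subgraphs G)"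
proof (rule finite_subset)
  show "connected_subgraphs G \<subseteq> Pow (verts G) \<times> Pow (Pow (verts G))"
    using assms by (fastforce simp: connected_subgraphs_def subgraph_def simple_graph_def)
  show "finite (Pow (verts G) \<times> Pow (Pow (verts G)))"
    using assms by (simp add: simple_graph_def)
qed

lemma simple_graph_complete_on: "finite S \<Longrightarrow> simple_graph (complete_on S)"
  by (auto simp: simple_graph_def complete_on_def)

text \<open>Every simple graph on a subset of \<open>S\<close> is a subgraph of the complete graph,
  so only connectedness remains as a condition once the vertex set is fixed.\<close>

lemma connected_subgraphs_complete_on:
  assumes "finite S"
  shows "connected_subgraphs (complete_on S) = (\<Union>T\<in>Pow S. connected_graphs_on T)"
  using finite_subset[OF _ assms]
  by (fastforce simp: connected_subgraphs_def subgraph_def complete_on_def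
      connected_graphs_on_def simple_graph_def)

text \<open>Sort the connected subgraphs by vertex set and then by its size \<open>i\<close>: each
  \<open>i\<close>-subset carries the same number of connected graphs.\<close>

lemma core_index_complete_on:
  assumes "finite S"
  shows "core_index (complete_on S) = complete_core_index (card S)"
proof -
  let ?h = num_connected_labeled and ?m = "card S"
  \<comment> \<open>Grouping subsets by size starts at 0, the target sum at 1. The two agree because
    the empty graph does not count as connected.\<close>
  have "{H :: nat ugraph. verts H = {1..0} \<and> simple_graph H \<and> connected_graph H} = {}"
    by (auto simp: connected_graph_def)
  then have h0: "?h 0 = 0"
    unfolding num_connected_labeled_def by (simp only: card.empty)
  have card_le: "card T \<le> ?m" if "T \<in> Pow S" for T
    using that assms by (simp add: card_mono)
  have "core_index (complete_on S) = card (\<Union>T\<in>Pow S. connected_graphs_on T)"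
    by (simp add: core_index_def connected_subgraphs_complete_on assms)
  also have "\<dots> = (\<Sum>T\<in>Pow S. card (connected_graphs_on T))"
    using assms by (intro card_UN_disjoint)
      (auto simp: connected_graphs_on_def intro!: finite_connected_graphs_on[unfolded connected_graphs_on_def]
        dest: finite_subset)
  also have "\<dots> = (\<Sum>T\<in>Pow S. ?h (card T))"
    using assms by (intro sum.cong) (auto intro: card_connected_graphs_on finite_subset)
  also have "\<dots> = (\<Sum>i\<in>{0..?m}. \<Sum>T\<in>{T\<in>Pow S. card T = i}. ?h (card T))"
    using assms card_le by (intro sum.group[symmetric]) auto
  also have "\<dots> = (\<Sum>i\<in>{0..?m}. (?m choose i) * ?h i)"
    using n_subsets[OF assms] by (intro sum.cong) auto
  also have "\<dots> = (\<Sum>i = 1..?m. (?m choose i) * ?h i)"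
    using h0 by (intro sum.mono_neutral_right) (auto simp: not_less_eq_eq)
  finally show ?thesis
    by (simp add: complete_core_index_def)
qed

section \<open>Superadditivity\<close>

lemma connected_graph_singleton: "connected_graph ({v}, {})"
  by (simp add: connected_graph_def reach_def)

lemma connected_graph_edge: "connected_graph ({u, v}, {{u, v}})"
  by (auto simp: connected_graph_def reach_def adj_def insert_commute)

lemma complete_core_index_1: "complete_core_index 1 = 1"
proof -
  have "card e \<noteq> 2" if "e \<subseteq> {0::nat}" for e
    using card_mono[OF _ that] by simp
  then have "connected_subgraphs (complete_on {0::nat}) = {({0}, {})}"
    using connected_graph_singleton
    by (auto simp: connected_subgraphs_def subgraph_def complete_on_def connected_graph_def)
  then show ?thesis
    using core_index_complete_on[of "{0::nat}"] by (simp add: core_index_def)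
qed

text \<open>A one-vertex subgraph is a witness. Positivity ensures that the truncated subtraction in
  \<open>g\<close> loses nothing.\<close>

lemma complete_core_index_pos: "0 < complete_core_index (Suc a)"
proof -
  have "({0}, {}) \<in> connected_subgraphs (complete_on {..a})"
    by (simp add: connected_subgraphs_def subgraph_def complete_on_def connected_graph_singleton)
  then have "core_index (complete_on {..a}) > 0"
    by (auto simp: core_index_def card_gt_0_iff simple_graph_complete_on finite_connected_subgraphs)
  then show ?thesis
    by (simp add: core_index_complete_on)
qed

lemma complete_core_index_superadditive:
  assumes "0 < a" "0 < b"
  shows "complete_core_index (Suc a) + complete_core_index (Suc b)
    < complete_core_index (Suc (a + b)) + 1"
proof -
  let ?K = "\<lambda>S :: nat set. connected_subgraphs (complete_on S)"
  \<comment> \<open>Blocks of \<open>a + 1\<close> and \<open>b + 1\<close> vertices sharing only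
    \<open>a\<close>. As \<open>a\<close> and \<open>b\<close> are positive, 0 lies outside
    \<open>?B\<close> and \<open>a+b\<close> outside \<open>?A\<close>, so the edge graph
    \<open>?E\<close> lies in neither block and makes the inequality strict.\<close>
  let ?A = "{..a}" and ?B = "{a..a+b}" and ?E = "({0, a+b}, {{0, a+b}})"
  have fin: "finite (?K S)" if "finite S" for S
    using that by (intro finite_connected_subgraphs simple_graph_complete_on)
  have "H = ({a}, {})" if "H \<in> ?K ?A \<inter> ?K ?B" for H
  proof -
    have sub: "verts H \<subseteq> {..a}" "verts H \<subseteq> {a..a+b}" "verts H \<noteq> {}"
      and ed: "\<forall>e\<in>edges H. e \<subseteq> verts H \<and> card e = 2"
      using that by (auto simp: connected_subgraphs_def subgraph_def complete_on_def connected_graph_def)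
    have "{..a} \<inter> {a..a+b} = {a}"
      by auto
    with sub have "verts H \<subseteq> {a}"
      by (metis Int_greatest)
    with sub have v: "verts H = {a}"
      by blast
    have "e \<notin> edges H" for e
      using ed v card_mono[of "{a}" e] by auto
    then have "edges H = {}"
      by blast
    with v show ?thesis
      by (simp add: prod_eq_iff)
  qed
  then have "card (?K ?A \<inter> ?K ?B) \<le> card {({a}, {} :: nat set set)}"
    by (intro card_mono) auto
  moreover have "card (?K ?A \<union> ?K ?B) < card (?K {..a+b})"
  proof (rule psubset_card_mono)
    have "?E \<in> ?K {..a+b}"
      using assms connected_graph_edge
      by (auto simp: connected_subgraphs_def subgraph_def complete_on_def)
    moreover have "?E \<notin> ?K ?A \<union> ?K ?B"
      using assms by (auto simp: connected_subgraphs_def subgraph_def complete_on_def)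
    moreover have "?K ?A \<union> ?K ?B \<subseteq> ?K {..a+b}"
      by (fastforce simp: connected_subgraphs_def subgraph_def complete_on_def)
    ultimately show "?K ?A \<union> ?K ?B \<subset> ?K {..a+b}"
      by blast
  qed (simp add: fin)
  moreover have "card (?K ?A) + card (?K ?B) = card (?K ?A \<union> ?K ?B) + card (?K ?A \<inter> ?K ?B)"
    by (rule card_Un_Int) (simp_all add: fin)
  moreover have "card (?K S) = complete_core_index (card S)" if "finite S" for S
    using core_index_complete_on[OF that] by (simp add: core_index_def)
  ultimately show ?thesis
    by simp
qed

text \<open>Both claims go through one induction, since the equality case for
  \<open>insert x A\<close> forces equality for \<open>A\<close> as well.\<close>

lemma sum_le_superadditive:
  fixes g :: "nat \<Rightarrow> nat"
  assumes g0: "g 0 = 0" and g: "\<And>a b. 0 < a \<Longrightarrow> 0 < b \<Longrightarrow> g a + g b < g (a + b)"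
    and "finite A"
  shows "(\<Sum>x\<in>A. g (f x)) \<le> g (\<Sum>x\<in>A. f x) \<and>
    ((\<Sum>x\<in>A. g (f x)) = g (\<Sum>x\<in>A. f x) \<longrightarrow> (\<forall>x\<in>A. \<forall>y\<in>A. x \<noteq> y \<longrightarrow> f x = 0 \<or> f y = 0))"
  using \<open>finite A\<close>
proof (induction A rule: finite_induct)
  case (insert x A)
  define s where "s = (\<Sum>y\<in>A. f y)"
  have le: "g (f x) + g s \<le> g (f x + s)"
    using g[of "f x" s] g0 by (cases "f x = 0"; cases "s = 0") auto
  have IH: "(\<Sum>y\<in>A. g (f y)) \<le> g s"
    using insert.IH by (simp add: s_def)
  have sums: "(\<Sum>y\<in>insert x A. g (f y)) = g (f x) + (\<Sum>y\<in>A. g (f y))"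
    "(\<Sum>y\<in>insert x A. f y) = f x + s"
    using insert.hyps by (simp_all add: s_def)
  have "\<forall>y\<in>insert x A. \<forall>z\<in>insert x A. y \<noteq> z \<longrightarrow> f y = 0 \<or> f z = 0"
    if eq: "g (f x) + (\<Sum>y\<in>A. g (f y)) = g (f x + s)"
  proof -
    \<comment> \<open>Equality of the outer terms makes both links of the chain tight: the induction
      hypothesis and \<open>le\<close>.\<close>
    have "(\<Sum>y\<in>A. g (f y)) = g s"
      using eq le IH by linarith
    then have "\<forall>y\<in>A. \<forall>z\<in>A. y \<noteq> z \<longrightarrow> f y = 0 \<or> f z = 0"
      using insert.IH by (simp add: s_def)
    \<comment> \<open>Were both positive, strict superadditivity would contradict \<open>eq\<close>.
      If \<open>s = 0\<close>, all its summands vanish, being natural numbers.\<close>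
    moreover have "f x = 0 \<or> s = 0"
      using eq IH g[of "f x" s] by fastforce
    then have "f x = 0 \<or> (\<forall>y\<in>A. f y = 0)"
      using insert.hyps by (simp add: s_def)
    ultimately show ?thesis
      by auto
  qed
  moreover have "g (f x) + (\<Sum>y\<in>A. g (f y)) \<le> g (f x + s)"
    using le IH by linarith
  ultimately show ?case
    unfolding sums by blast
qed (simp add: g0)

section \<open>Components\<close>

text \<open>The connected subgraphs of \<open>G\<close> form a subset of those of the complete
  graph. If the finite cardinalities agree, the sets coincide, and every possible edge is then
  present in \<open>G\<close>.\<close>

lemma core_index_le_complete_on:
  assumes "simple_graph G"
  shows "core_index G \<le> complete_core_index (card (verts G))"
    and "core_index G = complete_core_index (card (verts G)) \<Longrightarrow> G = complete_on (verts G)"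
proof -
  let ?K = "complete_on (verts G)"
  have fin: "finite (verts G)"
    using assms by (simp add: simple_graph_def)
  have sub: "connected_subgraphs G \<subseteq> connected_subgraphs ?K"
    using assms
    by (fastforce simp: connected_subgraphs_def subgraph_def complete_on_def simple_graph_def)
  have finK: "finite (connected_subgraphs ?K)"
    using fin by (intro finite_connected_subgraphs simple_graph_complete_on)
  have K: "card (connected_subgraphs ?K) = complete_core_index (card (verts G))"
    using core_index_complete_on[OF fin] by (simp add: core_index_def)
  show "core_index G \<le> complete_core_index (card (verts G))"
    using card_mono[OF finK sub] K by (simp add: core_index_def)
  assume "core_index G = complete_core_index (card (verts G))"
  then have eq: "connected_subgraphs G = connected_subgraphs ?K"
    using card_subset_eq[OF finK sub] K by (simp add: core_index_def)
  have "e \<in> edges G" if e: "e \<subseteq> verts G" "card e = 2" for e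
  proof -
    obtain u v where uv: "e = {u, v}"
      using e(2) by (auto simp: card_2_iff)
    \<comment> \<open>The subgraph consisting of the single edge \<open>e\<close> detects whether
      \<open>e\<close> belongs to \<open>G\<close>.\<close>
    have "(e, {e}) \<in> connected_subgraphs ?K"
      using e connected_graph_edge[of u v] uv
      by (simp add: connected_subgraphs_def subgraph_def complete_on_def)
    then show ?thesis
      unfolding eq[symmetric] by (simp add: connected_subgraphs_def subgraph_def)
  qed
  then show "G = ?K"
    using assms by (auto simp: complete_on_def simple_graph_def prod_eq_iff)
qed

text \<open>The vertex set recovers the class, so counts and sums over \<open>components G\<close>
  can be indexed by the classes of \<open>reach G\<close>.\<close>

lemma inj_induced_subgraph: "inj_on (induced_subgraph G) X"
  by (auto simp: inj_on_def induced_subgraph_def)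

lemma edge_within_class:
  assumes "simple_graph G" "e \<in> edges G"
  obtains C where "C \<in> verts G // reach G" "e \<subseteq> C"
proof -
  obtain u v where uv: "e = {u, v}"
    using assms by (auto simp: simple_graph_def card_2_iff)
  have "u \<in> verts G" "v \<in> verts G" "(u, v) \<in> adj G"
    using assms uv by (auto simp: simple_graph_def adj_def)
  then have "reach G `` {u} \<in> verts G // reach G" "e \<subseteq> reach G `` {u}"
    using uv by (auto simp: quotient_def reach_def)
  then show thesis
    by (rule that)
qed

text \<open>A connected subgraph either stays inside \<open>S\<close> or is a single isolated
  vertex. This evaluates the core index of the extremal graph.\<close>

lemma core_index_complete_plus_isolated:
  fixes V :: "'a set"
  assumes "finite V" "S \<subseteq> V" "edges G = {e. e \<subseteq> S \<and> card e = 2}" "verts G = V"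
  shows "core_index G = complete_core_index (card S) + card (V - S)"
proof -
  let ?K = "connected_subgraphs (complete_on S)" and ?I = "(\<lambda>v. ({v}, {} :: 'a set set)) ` (V - S)"
  have finS: "finite S"
    using assms finite_subset by blast
  have "connected_subgraphs G = ?K \<union> ?I"
  proof (intro equalityI subsetI)
    fix H assume H: "H \<in> connected_subgraphs G"
    show "H \<in> ?K \<union> ?I"
    proof (cases "verts H \<subseteq> S")
      case True
      then have "H \<in> ?K"
        using H assms by (auto simp: connected_subgraphs_def subgraph_def complete_on_def)
      then show ?thesis ..
    next
      case False
      then obtain v where v: "v \<in> verts H" "v \<notin> S"
        by blast
      \<comment> \<open>All edges lie in \<open>S\<close>, so a walk from \<open>v\<close> has no
        first step and only the empty walk remains.\<close>
      have "(v, w) \<notin> adj H" for w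
        using H v assms by (auto simp: connected_subgraphs_def subgraph_def adj_def)
      moreover have "(v, w) \<in> (adj H)\<^sup>*" if "w \<in> verts H" for w
        using H v that by (simp add: connected_subgraphs_def connected_graph_def reach_def)
      ultimately have "w = v" if "w \<in> verts H" for w
        using that by (metis converse_rtranclE)
      then have vH: "verts H = {v}"
        using v by blast
      have "edges H = {}"
      proof (rule ccontr)
        assume "edges H \<noteq> {}"
        then obtain e where "e \<in> edges H" by blast
        then have "e \<subseteq> {v}" "e \<subseteq> S" "card e = 2"
          using H vH assms by (auto simp: connected_subgraphs_def subgraph_def)
        then have "e = {}"
          using v by blast
        with \<open>card e = 2\<close> show False by simp
      qed
      moreover have "v \<in> V"
        using H vH assms by (auto simp: connected_subgraphs_def subgraph_def)
      ultimately have "H \<in> ?I"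
        using v vH by (force simp: prod_eq_iff)
      then show ?thesis ..
    qed
  next
    fix H assume "H \<in> ?K \<union> ?I"
    then show "H \<in> connected_subgraphs G"
      using assms connected_graph_singleton
      by (auto simp: connected_subgraphs_def subgraph_def complete_on_def)
  qed
  moreover have "card (?K \<union> ?I) = card ?K + card ?I"
  proof (rule card_Un_disjoint)
    show "finite ?K"
      using finS by (intro finite_connected_subgraphs simple_graph_complete_on)
  qed (use assms in \<open>auto simp: connected_subgraphs_def subgraph_def complete_on_def\<close>)
  moreover have "card ?I = card (V - S)"
    by (rule card_image) (simp add: inj_on_def)
  ultimately show ?thesis
    using core_index_complete_on[OF finS] by (simp add: core_index_def)
qed

section \<open>The extremal graph\<close>

lemma verts_extremal:
  "verts (disjoint_union (copies j (complete_graph 1)) (complete_graph m))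
    = Inl ` ({..<j} \<times> {..<1}) \<union> Inr ` {..<m}"
  by (simp add: disjoint_union_def copies_def complete_graph_def)

lemma edges_extremal:
  "edges (disjoint_union (copies j (complete_graph 1)) (complete_graph m))
    = (`) Inr ` {e. e \<subseteq> {..<m} \<and> card e = 2}"
proof -
  have "card e \<noteq> 2" if "e \<subseteq> {..<Suc 0}" for e
    using card_mono[OF _ that] by simp
  then show ?thesis
    by (auto simp: disjoint_union_def copies_def complete_graph_def)
qed

text \<open>Translates the isomorphism into a description inside \<open>G\<close>, in the form that
  \<open>core_index_complete_plus_isolated\<close> counts; \<open>S\<close> is the preimage of the
  complete summand.\<close>

lemma graph_iso_extremalD:
  assumes "simple_graph G"
    and "graph_iso G (disjoint_union (copies j (complete_graph 1)) (complete_graph m))"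
  obtains S where "S \<subseteq> verts G" "card S = m" "card (verts G - S) = j"
    "edges G = {e. e \<subseteq> S \<and> card e = 2}"
proof -
  let ?L = "({..<j} \<times> {..<1}) :: (nat \<times> nat) set"
  let ?R = "{..<m} :: nat set"
  let ?H = "disjoint_union (copies j (complete_graph 1)) (complete_graph m)"
  obtain f where f: "bij_betw f (verts G) (verts ?H)"
    and adj: "\<And>u v. u \<in> verts G \<Longrightarrow> v \<in> verts G \<Longrightarrow> {u, v} \<in> edges G \<longleftrightarrow> {f u, f v} \<in> edges ?H"
    using assms(2) unfolding graph_iso_def by blast
  have inj: "inj_on f (verts G)" and im: "f ` verts G = Inl ` ?L \<union> Inr ` ?R"
    using f verts_extremal[of j m] by (auto simp: bij_betw_def)
  define S where "S = {v \<in> verts G. f v \<in> Inr ` ?R}"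
  have "f ` S = f ` verts G \<inter> Inr ` ?R"
    by (auto simp: S_def)
  then have "f ` S = Inr ` ?R"
    unfolding im by blast
  moreover have "inj_on f S" "inj_on f (verts G - S)"
    using inj by (auto simp: S_def inj_on_def)
  moreover have "f ` (verts G - S) = Inl ` ?L"
  proof -
    have "f ` (verts G - S) = f ` verts G - Inr ` ?R"
      by (auto simp: S_def)
    then show ?thesis
      unfolding im by blast
  qed
  ultimately have card_S: "card S = card (Inr ` ?R :: ((nat \<times> nat) + nat) set)"
    and card_D: "card (verts G - S) = card (Inl ` ?L :: ((nat \<times> nat) + nat) set)"
    by (metis card_image)+
  \<comment> \<open>Distinctness is essential: for \<open>u = v\<close> in \<open>S\<close> the set
    is a singleton and not an edge.\<close>
  have pair: "{u, v} \<in> edges G \<longleftrightarrow> u \<in> S \<and> v \<in> S"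
    if uv: "u \<in> verts G" "v \<in> verts G" "u \<noteq> v" for u v
  proof
    assume "{u, v} \<in> edges G"
    then have "{f u, f v} \<in> edges ?H"
      using adj uv by blast
    then have "{f u, f v} \<subseteq> Inr ` ?R"
      unfolding edges_extremal by blast
    then show "u \<in> S \<and> v \<in> S"
      using uv by (simp add: S_def)
  next
    assume "u \<in> S \<and> v \<in> S"
    then obtain x y where xy: "f u = Inr x" "x < m" "f v = Inr y" "y < m"
      by (auto simp: S_def)
    have "x \<noteq> y"
      using inj uv xy by (auto simp: inj_on_def)
    then have "{f u, f v} \<in> edges ?H"
      unfolding edges_extremal using xy by (intro image_eqI[of _ _ "{x, y}"]) auto
    then show "{u, v} \<in> edges G"
      using adj uv by blast
  qed
  have "edges G = {e. e \<subseteq> S \<and> card e = 2}"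
  proof (intro equalityI subsetI)
    fix e assume e: "e \<in> edges G"
    then obtain u v where "e = {u, v}" "u \<noteq> v" "u \<in> verts G" "v \<in> verts G" "card e = 2"
      using assms(1) by (auto simp: simple_graph_def card_2_iff)
    then show "e \<in> {e. e \<subseteq> S \<and> card e = 2}"
      using pair e by auto
  next
    fix e assume "e \<in> {e. e \<subseteq> S \<and> card e = 2}"
    then obtain u v where "e = {u, v}" "u \<noteq> v" "u \<in> S" "v \<in> S"
      by (auto simp: card_2_iff)
    then show "e \<in> edges G"
      using pair[of u v] by (auto simp: S_def)
  qed
  moreover have "S \<subseteq> verts G"
    by (auto simp: S_def)
  moreover have "card S = m" "card (verts G - S) = j"
    using card_S card_D by (simp_all add: card_image)
  ultimately show thesis
    using that by blast
qed

text \<open>The isomorphism is glued from a bijection of \<open>S\<close> onto the complete summand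
  and one of the remaining vertices onto the isolated ones.\<close>

lemma graph_iso_extremalI:
  assumes "finite (verts G)" "S \<subseteq> verts G" "card S = m" "card (verts G - S) = j"
    and eG: "edges G = {e. e \<subseteq> S \<and> card e = 2}"
  shows "graph_iso G (disjoint_union (copies j (complete_graph 1)) (complete_graph m))"
proof -
  let ?L = "({..<j} \<times> {..<1}) :: (nat \<times> nat) set"
  let ?R = "{..<m} :: nat set"
  let ?H = "disjoint_union (copies j (complete_graph 1)) (complete_graph m)"
  have finS: "finite S"
    using assms finite_subset by blast
  obtain p where p: "bij_betw p S ?R"
    using finite_same_card_bij[OF finS, of ?R] assms(3) by auto
  obtain q where q: "bij_betw q (verts G - S) ?L"
    using finite_same_card_bij[of "verts G - S" ?L] assms(1,4) by auto
  define f where "f v = (if v \<in> S then Inr (p v) else Inl (q v))" for v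
  have "bij_betw f S (Inr ` ?R)"
    using p by (auto simp: f_def bij_betw_def inj_on_def)
  moreover have "bij_betw f (verts G - S) (Inl ` ?L)"
    using q by (auto simp: f_def bij_betw_def inj_on_def)
  ultimately have "bij_betw f (S \<union> (verts G - S)) (Inr ` ?R \<union> Inl ` ?L)"
    by (rule bij_betw_combine) auto
  moreover have "S \<union> (verts G - S) = verts G"
    using assms(2) by blast
  ultimately have f: "bij_betw f (verts G) (verts ?H)"
    unfolding verts_extremal by (simp add: Un_commute)
  have "{u, v} \<in> edges G \<longleftrightarrow> {f u, f v} \<in> edges ?H"
    if uv: "u \<in> verts G" "v \<in> verts G" for u v
  proof
    assume "{u, v} \<in> edges G"
    then have *: "u \<in> S" "v \<in> S" "card {u, v} = 2"
      by (auto simp: eG)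
    then have "p u \<noteq> p v"
      using p by (auto simp: bij_betw_def inj_on_def)
    moreover have "p u \<in> ?R" "p v \<in> ?R"
      using p * by (auto simp: bij_betw_def)
    ultimately show "{f u, f v} \<in> edges ?H"
      unfolding edges_extremal using * by (intro image_eqI[of _ _ "{p u, p v}"]) (auto simp: f_def)
  next
    assume "{f u, f v} \<in> edges ?H"
    then obtain e where e: "{f u, f v} = Inr ` e" "card e = 2"
      unfolding edges_extremal by blast
    then have "f u \<in> range Inr" "f v \<in> range Inr"
      by blast+
    then have "u \<in> S" "v \<in> S"
      by (auto simp: f_def split: if_splits)
    \<comment> \<open>\<open>graph_iso\<close> also quantifies over \<open>u = v\<close>; the size
      of the image pair excludes that case.\<close>
    moreover have "card {f u, f v} = 2"
      using e by (simp add: card_image)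
    then have "u \<noteq> v"
      by auto
    ultimately show "{u, v} \<in> edges G"
      by (simp add: eG)
  qed
  with f show ?thesis
    unfolding graph_iso_def by blast
qed

section \<open>Summing over components: the bound and its equality case\<close>

theorem theorem2p3:
  fixes G :: "'a ugraph" and n k :: nat
  assumes "1 \<le> k" and "k \<le> n"
    and "simple_graph G"
    and "card (verts G) = n"
    and "card (components G) = k"
  shows "core_index G \<le> (k - 1) + (\<Sum>i = 1..n - k + 1. ((n - k + 1) choose i) * num_connected_labeled i)
    \<and> (core_index G = (k - 1) + (\<Sum>i = 1..n - k + 1. ((n - k + 1) choose i) * num_connected_labeled i)
        \<longleftrightarrow> graph_iso G (disjoint_union (copies (k - 1) (complete_graph 1)) (complete_graph (n - k + 1))))"
proof -
  let ?Q = "verts G // reach G" and ?N = complete_core_index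
  \<comment> \<open>Shifting the order by one makes the arguments \<open>card C - 1\<close> add up
    to \<open>n - k\<close>; subtracting 1 makes \<open>g 0 = 0\<close>.\<close>
  define g where "g a = ?N (Suc a) - 1" for a
  have g0: "g 0 = 0"
    using complete_core_index_1 by (simp add: g_def)
  have N_g: "?N (Suc a) = g a + 1" for a
    using complete_core_index_pos[of a] by (simp add: g_def)
  have g_super: "g a + g b < g (a + b)" if "0 < a" "0 < b" for a b
    using complete_core_index_superadditive[OF that] by (simp add: N_g)
  have fin: "finite (verts G)"
    using assms(3) by (simp add: simple_graph_def)
  have finQ: "finite ?Q"
    using fin by (intro finite_quotient) (auto simp: reach_def)
  have cardQ: "card ?Q = k"
    using assms(5) card_image[OF inj_induced_subgraph[of G ?Q]] by (simp add: components_def)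
  have Q: "finite C" "C \<noteq> {}" "C \<subseteq> verts G" if "C \<in> ?Q" for C
    using that fin in_quotient_imp_subset[OF equiv_reach that]
      in_quotient_imp_non_empty[OF equiv_reach that] by (auto intro: finite_subset)
  have card_pos: "card C = Suc (card C - 1)" if "C \<in> ?Q" for C
    using Q[OF that] by (simp add: card_gt_0_iff)
  have "card (\<Union>?Q) = (\<Sum>C\<in>?Q. card C)"
  proof (rule card_Union_disjoint)
    show "pairwise disjnt ?Q"
      unfolding pairwise_def disjnt_def using quotient_disj[OF equiv_reach[of G]] by blast
  qed (rule Q)
  then have "n = (\<Sum>C\<in>?Q. card C)"
    using assms(4) by (simp add: Union_quotient[OF equiv_reach])
  also have "\<dots> = (\<Sum>C\<in>?Q. (card C - 1) + 1)"
    using card_pos by (intro sum.cong) auto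
  finally have "n = (\<Sum>C\<in>?Q. card C - 1) + k"
    using cardQ by (simp only: sum.distrib) simp
  then have sum_card: "(\<Sum>C\<in>?Q. card C - 1) = n - k"
    by simp
  have simple: "simple_graph (induced_subgraph G C)" if "C \<in> ?Q" for C
    using assms(3) Q[OF that] by (auto simp: simple_graph_def induced_subgraph_def)
  have core: "core_index G = (\<Sum>C\<in>?Q. core_index (induced_subgraph G C))"
    unfolding core_index_eq_sum_components[OF assms(3)] components_def
    by (simp add: sum.reindex[OF inj_induced_subgraph])
  have comp_le: "core_index (induced_subgraph G C) \<le> g (card C - 1) + 1" if "C \<in> ?Q" for C
    using core_index_le_complete_on(1)[OF simple[OF that]] N_g[of "card C - 1"] card_pos[OF that]
    by (simp add: induced_subgraph_def)
  have sum_g: "(\<Sum>C\<in>?Q. g (card C - 1) + 1) = (\<Sum>C\<in>?Q. g (card C - 1)) + k"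
    using cardQ by (simp only: sum.distrib) simp
  have le1: "core_index G \<le> (\<Sum>C\<in>?Q. g (card C - 1)) + k"
    unfolding core sum_g[symmetric] by (rule sum_mono) (rule comp_le)
  have super: "(\<Sum>C\<in>?Q. g (card C - 1)) \<le> g (n - k) \<and>
    ((\<Sum>C\<in>?Q. g (card C - 1)) = g (n - k) \<longrightarrow>
      (\<forall>C\<in>?Q. \<forall>D\<in>?Q. C \<noteq> D \<longrightarrow> card C - 1 = 0 \<or> card D - 1 = 0))"
    unfolding sum_card[symmetric] using g0 g_super finQ by (rule sum_le_superadditive)
  \<comment> \<open>The sum is \<open>g (n - k) + 1\<close>, and its 1 turns \<open>k - 1\<close>
    into \<open>k\<close> because \<open>k\<close> is at least 1.\<close>
  have bound: "(k - 1) + (\<Sum>i = 1..n - k + 1. ((n - k + 1) choose i) * num_connected_labeled i) = g (n - k) + k"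
    using N_g[of "n - k"] assms(1) by (simp add: complete_core_index_def)
  have "graph_iso G (disjoint_union (copies (k - 1) (complete_graph 1)) (complete_graph (n - k + 1)))"
    if eq: "core_index G = g (n - k) + k"
  proof -
    \<comment> \<open>Equality overall makes both \<open>le1\<close> and \<open>super\<close>
      tight.\<close>
    have sum_eq: "(\<Sum>C\<in>?Q. g (card C - 1)) = g (n - k)"
      using eq le1 super by linarith
    have "core_index (induced_subgraph G C) = g (card C - 1) + 1" if "C \<in> ?Q" for C
    \<comment> \<open>Termwise inequalities with equal finite sums are termwise equalities.\<close>
    proof (rule sum_mono_inv[OF _ _ that finQ])
      show "(\<Sum>C\<in>?Q. core_index (induced_subgraph G C)) = (\<Sum>C\<in>?Q. g (card C - 1) + 1)"
        using eq sum_eq unfolding core sum_g by simp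
    qed (rule comp_le)
    then have compl: "induced_subgraph G C = complete_on C" if "C \<in> ?Q" for C
      using core_index_le_complete_on(2)[OF simple[OF that]] N_g[of "card C - 1"] card_pos[OF that] that
      by (simp add: induced_subgraph_def)
    have one: "\<forall>C\<in>?Q. \<forall>D\<in>?Q. C \<noteq> D \<longrightarrow> card C - 1 = 0 \<or> card D - 1 = 0"
      using super sum_eq by simp
    have "?Q \<noteq> {}"
      using cardQ assms(1) by auto
    \<comment> \<open>Take the class with more than one vertex if there is one, and any class
      otherwise.\<close>
    then obtain S where S: "S \<in> ?Q" "\<And>C. C \<in> ?Q \<Longrightarrow> C \<noteq> S \<Longrightarrow> card C - 1 = 0"
      using one by (metis ex_in_conv)
    have "(\<Sum>C\<in>?Q. card C - 1) = card S - 1"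
      using S finQ by (simp add: sum.remove[OF finQ S(1)])
    then have card_S: "card S = n - k + 1"
      using sum_card card_pos[OF S(1)] by simp
    have "edges G = {e. e \<subseteq> S \<and> card e = 2}"
    proof (intro equalityI subsetI)
      fix e assume e: "e \<in> edges G"
      obtain C where C: "C \<in> ?Q" "e \<subseteq> C"
        using edge_within_class[OF assms(3) e] .
      have "card e = 2"
        using e assms(3) by (simp add: simple_graph_def)
      moreover have "card e \<le> card C"
        using C Q(1) by (intro card_mono)
      \<comment> \<open>A class containing an edge has at least two vertices, whereas every class
        other than \<open>S\<close> has just one.\<close>
      ultimately have "C = S"
        using S(2)[OF C(1)] by fastforce
      with C \<open>card e = 2\<close> show "e \<in> {e. e \<subseteq> S \<and> card e = 2}"
        by simp
    next
      fix e assume "e \<in> {e. e \<subseteq> S \<and> card e = 2}"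
      then show "e \<in> edges G"
        using compl[OF S(1)] by (auto simp: induced_subgraph_def complete_on_def)
    qed
    moreover have "card (verts G - S) = k - 1"
      using Q[OF S(1)] card_S assms by (simp add: card_Diff_subset)
    ultimately show ?thesis
      using graph_iso_extremalI[OF fin Q(3)[OF S(1)] card_S] by simp
  qed
  moreover have "core_index G = g (n - k) + k"
    if iso: "graph_iso G (disjoint_union (copies (k - 1) (complete_graph 1)) (complete_graph (n - k + 1)))"
  proof -
    obtain S where "S \<subseteq> verts G" "card S = n - k + 1" "card (verts G - S) = k - 1"
      "edges G = {e. e \<subseteq> S \<and> card e = 2}"
      using graph_iso_extremalD[OF assms(3) iso] .
    then show ?thesis
      using core_index_complete_plus_isolated[OF fin, of S G] N_g[of "n - k"] assms(1) by simp
  qed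
  moreover have "core_index G \<le> g (n - k) + k"
    using le1 super by linarith
  ultimately show ?thesis
    unfolding bound by blast
qed

end
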